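(* Let $p$ be a prime, let $r$ and $n$ be positive integers with $3\le r<p$, and let $G=C_{p^n}^r$. Then for every integer $k$ with $2\le k\le p-r+1$, $$\mathsf D(G)+\left\lceil \frac{k}{r-1}\right\rceil\le \mathsf{s}_{\le \mathsf D(G)-k}(G)\le \mathsf D(G)+k.$$
   Context: $C_m$ denotes the cyclic group of order $m$, written additively, and $C_m^r$ is the direct sum of $r$ copies of $C_m$. For a finite abelian group $G$ (written additively), a sequence over $G$ is a finite unordered list of elements of $G$ with repetition allowed (a finite multiset); its length is its number of terms counted with multiplicity, and it is zero-sum if the sum of its terms (with multiplicity) is $0$. A subsequence is a sub-multiset. The Davenport constant $\mathsf D(G)$ is the smallest integer $\ell$ such that every sequence over $G$ of length $\ell$ has a nonempty zero-sum subsequence. For an integer $t$ with $\exp(G)\le t\le \mathsf D(G)$, where $\exp(G)$ is the exponent of $G$, $\mathsf{s}_{\le t}(G)$ denotes the smallest integer $\ell$ such that every sequence over $G$ of length $\ell$ has a zero-sum subsequence $T$ of length $1\le |T|\le t$. *)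

theory Defs
  imports
    "HOL-Algebra.FiniteProduct"
    "HOL-Algebra.Product_Groups"
    "HOL-Computational_Algebra.Primes"
    "HOL-Library.Multiset"
    Complex_Main
begin

text \<open>
  Groups are in the multiplicative notation of HOL-Algebra: the neutral element (the zero of the
  additively written group) is \<open>\<one>\<close>, and a multiple \<open>m g\<close> is \<open>g [^] m\<close>.
\<close>

definition seq_over :: "('a, 'b) monoid_scheme \<Rightarrow> 'a multiset \<Rightarrow> bool" where
  "seq_over G S \<longleftrightarrow> set_mset S \<subseteq> carrier G"

text \<open>
  \<^const>\<open>finprod\<close> ranges over a set, so repeated terms enter through the exponent. This is the sum of
  the terms only for a commutative group and a sequence over its carrier.
\<close>

definition seq_sum :: "('a, 'b) monoid_scheme \<Rightarrow> 'a multiset \<Rightarrow> 'a" where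
  "seq_sum G S = finprod G (\<lambda>g. g [^]\<^bsub>G\<^esub> count S g) (set_mset S)"

definition zero_sum :: "('a, 'b) monoid_scheme \<Rightarrow> 'a multiset \<Rightarrow> bool" where
  "zero_sum G S \<longleftrightarrow> seq_sum G S = \<one>\<^bsub>G\<^esub>"

definition davenport :: "('a, 'b) monoid_scheme \<Rightarrow> nat" where
  "davenport G = (LEAST l. \<forall>S. seq_over G S \<and> size S = l \<longrightarrow>
     (\<exists>T. T \<subseteq># S \<and> T \<noteq> {#} \<and> zero_sum G T))"

text \<open>
  For a finite abelian group \<open>G\<close>, a length as required exists whenever \<open>t\<close> is at least the exponent
  of \<open>G\<close>; for smaller \<open>t\<close> there need not be one, and then the value is unspecified.
\<close>

definition s_le :: "nat \<Rightarrow> ('a, 'b) monoid_scheme \<Rightarrow> nat" where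
  "s_le t G = (LEAST l. \<forall>S. seq_over G S \<and> size S = l \<longrightarrow>
     (\<exists>T. T \<subseteq># S \<and> 1 \<le> size T \<and> size T \<le> t \<and> zero_sum G T))"

text \<open>The direct sum of \<open>r\<close> copies of the cyclic group of order \<open>m\<close> (for positive \<open>m\<close>).\<close>

definition cyclic_power :: "nat \<Rightarrow> nat \<Rightarrow> (nat \<Rightarrow> int) monoid" where
  "cyclic_power m r = product_group {..<r} (\<lambda>_. integer_mod_group m)"

end

theory Submission
  imports Defs
begin

text \<open>
  Put \<open>q = p\<^sup>n\<close>. For integers \<open>s \<ge> 0\<close> the number \<open>(s + q - 1) choose (q - 1)\<close>, a polynomial of degree
  \<open>q - 1\<close> in \<open>s\<close>, is divisible by \<open>p\<close> unless \<open>q\<close> divides \<open>s\<close>. The product of these polynomials over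
  the \<open>r\<close> coordinates of the sum of a subsequence \<open>T\<close>, times \<open>\<Prod>j\<in>J. |T| - j\<close>, is a polynomial of
  degree \<open>r (q - 1) + |J|\<close> in the indicator variables of \<open>T\<close>. Its alternating sum over all
  subsequences of a longer sequence therefore vanishes. If \<open>p\<close> divides no element of \<open>J\<close>, the empty
  subsequence contributes a unit modulo \<open>p\<close>, so some nonempty zero-sum \<open>T\<close> has \<open>|T| \<notin> J\<close>. With
  \<open>J = {}\<close> this gives \<open>D = r (q - 1) + 1\<close> for the Davenport constant \<open>D\<close>. With
  \<open>J = {D - k + 1..D}\<close> it gives the upper bound, because a zero-sum \<open>T\<close> longer than \<open>D\<close> splits into
  two zero-sum parts, which cannot both be longer than \<open>D - k\<close>. The lower bound comes from \<open>q - 1\<close>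
  copies of each basis element together with \<open>c = \<lceil>k / (r - 1)\<rceil>\<close> copies of the sum of the basis: a
  nonempty zero-sum subsequence contains \<open>j\<close> of the latter, with \<open>1 \<le> j \<le> c\<close>, and \<open>q - j\<close> copies of
  each basis element.
\<close>

section \<open>Alternating sums and binomial coefficients modulo p\<close>

text \<open>Up to sign this is an iterated finite difference, one for each element of
  \<open>I\<close>, of a polynomial of degree at most \<open>card J\<close>. Pairing
  \<open>T\<close> with \<open>insert x T\<close> and expanding the product cancels the term
  \<open>K = {}\<close>; the induction applies to the other terms, which have fewer affine
  factors.\<close>

lemma alternating_sum_prod_affine_eq_0:
  fixes a :: "'j \<Rightarrow> 'i \<Rightarrow> 'a::comm_ring_1"
  assumes "finite I" "finite J" "card J < card I"
  shows "(\<Sum>T\<in>Pow I. (-1) ^ card T * (\<Prod>j\<in>J. c j + (\<Sum>i\<in>T. a j i))) = 0"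
  using assms
proof (induction I arbitrary: J rule: finite_induct)
  case empty
  then show ?case by simp
next
  case (insert x I)
  define L where "L j T = c j + (\<Sum>i\<in>T. a j i)" for j T
  have step: "(-1) ^ card T * (\<Prod>j\<in>J. L j T) + (-1) ^ card (insert x T) * (\<Prod>j\<in>J. L j (insert x T))
      = - (\<Sum>K\<in>Pow J - {{}}. (\<Prod>j\<in>K. a j x) * ((-1) ^ card T * (\<Prod>j\<in>J - K. L j T)))"
    if "T \<in> Pow I" for T
  proof -
    have T: "finite T" "x \<notin> T"
      using that insert.hyps by (auto intro: finite_subset)
    have "(\<Prod>j\<in>J. L j (insert x T)) = (\<Prod>j\<in>J. a j x + L j T)"
      using T by (simp add: L_def algebra_simps)
    also have "\<dots> = (\<Sum>K\<in>Pow J. (\<Prod>j\<in>K. a j x) * (\<Prod>j\<in>J - K. L j T))"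
      using insert.prems by (simp add: prod_add)
    also have "\<dots> = (\<Prod>j\<in>J. L j T) + (\<Sum>K\<in>Pow J - {{}}. (\<Prod>j\<in>K. a j x) * (\<Prod>j\<in>J - K. L j T))"
      using insert.prems by (subst sum.remove[of _ "{}"]) auto
    finally show ?thesis
      using T by (simp add: algebra_simps sum_distrib_left sum_negf)
  qed
  have "(\<Sum>T\<in>Pow (insert x I). (-1) ^ card T * (\<Prod>j\<in>J. L j T))
      = (\<Sum>T\<in>Pow I. (-1) ^ card T * (\<Prod>j\<in>J. L j T))
        + (\<Sum>T\<in>insert x ` Pow I. (-1) ^ card T * (\<Prod>j\<in>J. L j T))"
    unfolding Pow_insert using insert.hyps by (intro sum.union_disjoint) auto
  also have "(\<Sum>T\<in>insert x ` Pow I. (-1) ^ card T * (\<Prod>j\<in>J. L j T))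
      = (\<Sum>T\<in>Pow I. (-1) ^ card (insert x T) * (\<Prod>j\<in>J. L j (insert x T)))"
    using insert.hyps by (subst sum.reindex) (auto intro!: inj_onI simp: insert_ident)
  also have "(\<Sum>T\<in>Pow I. (-1) ^ card T * (\<Prod>j\<in>J. L j T)) + \<dots>
      = (\<Sum>T\<in>Pow I. - (\<Sum>K\<in>Pow J - {{}}. (\<Prod>j\<in>K. a j x) * ((-1) ^ card T * (\<Prod>j\<in>J - K. L j T))))"
    unfolding sum.distrib[symmetric] by (intro sum.cong refl step)
  also have "\<dots> = - (\<Sum>K\<in>Pow J - {{}}. (\<Prod>j\<in>K. a j x) *
      (\<Sum>T\<in>Pow I. (-1) ^ card T * (\<Prod>j\<in>J - K. L j T)))"
    unfolding sum_negf sum_distrib_left by (subst sum.swap) (rule refl)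
  also have "\<dots> = 0"
  proof -
    have "(\<Sum>T\<in>Pow I. (-1) ^ card T * (\<Prod>j\<in>J - K. L j T)) = 0" if "K \<in> Pow J - {{}}" for K
    proof -
      have "J - K \<subset> J" using that by auto
      then have "card (J - K) < card J"
        using insert.prems by (intro psubset_card_mono)
      then show ?thesis
        using insert unfolding L_def by (intro insert.IH) auto
    qed
    then show ?thesis by simp
  qed
  finally show ?case by (simp add: L_def)
qed

text \<open>Brings the binomial coefficient into the shape to which
  \<open>alternating_sum_prod_affine_eq_0\<close> applies.\<close>

lemma prod_shift_eq_fact_binomial:
  "(\<Prod>m<N. int s + (1 + int m)) = fact N * int ((s + N) choose N)"
proof (induction N)
  case (Suc N)
  have "Suc N * ((s + Suc N) choose Suc N) = (s + Suc N) * ((s + N) choose N)"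
    using Suc_times_binomial[of N "s + N"] by simp
  then have "int (Suc N) * int ((s + Suc N) choose Suc N) = int (s + Suc N) * int ((s + N) choose N)"
    by (metis of_nat_mult)
  then have "fact (Suc N) * int ((s + Suc N) choose Suc N)
      = int (s + Suc N) * (fact N * int ((s + N) choose N))"
    by (simp only: fact_Suc of_nat_id of_nat_fact mult.assoc mult.left_commute mult.commute)
  then show ?case
    using Suc by (simp add: algebra_simps)
qed simp

text \<open>With q = p^n and B the binomial coefficient, s * B is a multiple of q. If p did not
  divide B, then B would be coprime to q, and q would divide s.\<close>

lemma prime_dvd_binomial_add:
  fixes p :: nat
  assumes "prime p" "\<not> p ^ n dvd s"
  shows "p dvd ((s + (p ^ n - 1)) choose (p ^ n - 1))"
proof (rule ccontr)
  define q where "q = p ^ n"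
  have q: "q > 0" using assms(1) by (simp add: q_def prime_gt_0_nat)
  have s: "s > 0" using assms(2) by (cases s) auto
  assume "\<not> p dvd ((s + (p ^ n - 1)) choose (p ^ n - 1))"
  then have *: "coprime q ((s + (q - 1)) choose (q - 1))"
    using assms(1) by (simp add: q_def prime_imp_coprime_nat)
  obtain s' q' where sq: "s = Suc s'" "q = Suc q'"
    using s q by (metis gr0_implies_Suc)
  have "s * ((s + (q - 1)) choose (q - 1)) = s * ((s + (q - 1)) choose s)"
    using binomial_symmetric[of s "s + (q - 1)"] by simp
  also have "\<dots> = q * ((s + (q - 1)) choose (s - 1))"
    using Suc_times_binomial_add[of s' q'] by (simp add: sq)
  finally have "q dvd s * ((s + (q - 1)) choose (q - 1))" by simp
  with * have "q dvd s" by (simp add: coprime_dvd_mult_left_iff)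
  with assms(2) show False by (simp add: q_def)
qed

section \<open>Sums of sequences, coordinate by coordinate\<close>

lemma (in comm_group) seq_sum_add_mset:
  assumes "seq_over G (add_mset x S)"
  shows "seq_sum G (add_mset x S) = x \<otimes> seq_sum G S"
proof -
  let ?A = "insert x (set_mset S)"
  have A: "?A \<subseteq> carrier G" using assms by (simp add: seq_over_def)
  have "seq_sum G (add_mset x S)
      = (\<Otimes>g\<in>?A. (if g = x then g else \<one>) \<otimes> g [^] count S g)"
    unfolding seq_sum_def using A
    by (intro finprod_cong') (auto simp: nat_pow_Suc2 m_comm)
  also have "\<dots> = (\<Otimes>g\<in>?A. if g = x then g else \<one>) \<otimes> (\<Otimes>g\<in>?A. g [^] count S g)"
    using A by (intro finprod_multf) auto
  also have "(\<Otimes>g\<in>?A. if g = x then g else \<one>) = x"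
    using A finprod_singleton_swap[of x ?A "\<lambda>g. g"] by auto
  also have "(\<Otimes>g\<in>?A. g [^] count S g) = seq_sum G S"
    unfolding seq_sum_def using A
    by (intro finprod_mono_neutral_cong_right) (auto simp: not_in_iff)
  finally show ?thesis .
qed

lemma comm_group_cyclic_power: "comm_group (cyclic_power m r)"
  unfolding cyclic_power_def
  by (rule group.group_comm_groupI) (auto simp: add.commute)

lemma seq_sum_cyclic_power:
  assumes "seq_over (cyclic_power m r) S"
  shows "seq_sum (cyclic_power m r) S = (\<lambda>i\<in>{..<r}. (\<Sum>x\<in>#S. x i) mod int m)"
  using assms
proof (induction S)
  case empty
  interpret comm_group "cyclic_power m r" by (rule comm_group_cyclic_power)
  show ?case by (simp add: seq_sum_def) (simp add: cyclic_power_def)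
next
  case (add x S)
  interpret comm_group "cyclic_power m r" by (rule comm_group_cyclic_power)
  have S: "seq_over (cyclic_power m r) S"
    using add.prems by (simp add: seq_over_def)
  show ?case
    unfolding seq_sum_add_mset[OF add.prems] add.IH[OF S]
    by (auto simp: cyclic_power_def mod_simps)
qed

lemma zero_sum_cyclic_power_iff:
  assumes "seq_over (cyclic_power m r) S"
  shows "zero_sum (cyclic_power m r) S \<longleftrightarrow> (\<forall>i<r. int m dvd (\<Sum>x\<in>#S. x i))"
  unfolding zero_sum_def seq_sum_cyclic_power[OF assms]
  by (auto simp: cyclic_power_def fun_eq_iff restrict_def mod_eq_0_iff_dvd)

lemma carrier_cyclic_power_nonneg:
  assumes "m > 0" "x \<in> carrier (cyclic_power m r)" "i < r"
  shows "x i \<ge> 0"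
  using assms by (auto simp: cyclic_power_def carrier_integer_mod_group PiE_iff)

section \<open>Zero-sum subsequences avoiding given lengths\<close>

lemma exists_zero_sum_avoiding_lengths:
  fixes p n r :: nat
  defines "G \<equiv> cyclic_power (p ^ n) r"
  assumes p: "prime p" and S: "seq_over G S"
    and J: "finite J" "\<And>j. j \<in> J \<Longrightarrow> \<not> p dvd j"
    and size: "r * (p ^ n - 1) + card J < size S"
  obtains T where "T \<subseteq># S" "T \<noteq> {#}" "zero_sum G T" "size T \<notin> J"
proof (rule ccontr)
  assume "\<not> thesis"
  with that have all_in_J: "size T \<in> J" if "T \<subseteq># S" "T \<noteq> {#}" "zero_sum G T" for T
    using that by blast
  define N where "N = p ^ n - 1"
  have q: "p ^ n > 0" using p by (simp add: prime_gt_0_nat)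
  obtain xs where xs: "mset xs = S" using ex_mset by blast
  \<comment> \<open>Subsequences are represented by sets of indices, so that equal terms of
    \<open>S\<close> keep separate indicator variables.\<close>
  define I where "I = {..<length xs}"
  define s where "s i T = (\<Sum>t\<in>T. nat ((xs ! t) i))" for i T
  define W where "W T = (-1) ^ card T *
      ((\<Prod>i<r. int ((s i T + N) choose N)) * (\<Prod>j\<in>J. int (card T) - int j))" for T
  \<comment> \<open>\<open>Inl (i, m)\<close> indexes the affine factor \<open>s i T + 1 + m\<close> of a binomial coefficient, \<open>Inr j\<close> the
    factor \<open>|T| - j\<close>\<close>
  define c where "c z = (case z of Inl (i, m) \<Rightarrow> 1 + int m | Inr j \<Rightarrow> - int j)"
    for z :: "(nat \<times> nat) + nat"
  define a where "a z t = (case z of Inl (i, m) \<Rightarrow> int (nat ((xs ! t) i)) | Inr j \<Rightarrow> 1)"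
    for z :: "(nat \<times> nat) + nat" and t
  define Z where "Z = ({..<r} \<times> {..<N}) <+> J"
  have Z: "finite Z" "card Z < card I"
    using J(1) size by (auto simp: Z_def card_Plus card_cartesian_product I_def N_def xs[symmetric])
  have prod_Z: "(\<Prod>z\<in>Z. c z + (\<Sum>t\<in>T. a z t))
      = fact N ^ r * ((\<Prod>i<r. int ((s i T + N) choose N)) * (\<Prod>j\<in>J. int (card T) - int j))" for T
  proof -
    have "(\<Prod>z\<in>Z. c z + (\<Sum>t\<in>T. a z t))
        = (\<Prod>(i, m)\<in>{..<r} \<times> {..<N}. int (s i T) + (1 + int m)) * (\<Prod>j\<in>J. int (card T) - int j)"
      unfolding Z_def using J(1)
      by (subst prod.Plus) (auto simp: c_def a_def s_def algebra_simps intro!: arg_cong2[where f="(*)"] prod.cong)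
    also have "(\<Prod>(i, m)\<in>{..<r} \<times> {..<N}. int (s i T) + (1 + int m))
        = fact N ^ r * (\<Prod>i<r. int ((s i T + N) choose N))"
      by (simp add: prod.cartesian_product[symmetric] prod_shift_eq_fact_binomial prod.distrib)
    finally show ?thesis by (simp add: mult.assoc)
  qed
  have "fact N ^ r * (\<Sum>T\<in>Pow I. W T) = (\<Sum>T\<in>Pow I. (-1) ^ card T * (\<Prod>z\<in>Z. c z + (\<Sum>t\<in>T. a z t)))"
    unfolding prod_Z W_def sum_distrib_left by (intro sum.cong refl) (simp add: mult_ac)
  also have "\<dots> = 0"
    using Z by (intro alternating_sum_prod_affine_eq_0) (auto simp: I_def)
  \<comment> \<open>\<open>fact N\<close> may be divisible by \<open>p\<close>, but the identity
    holds over the integers, so the factor cancels before anything is reduced modulo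
    \<open>p\<close>.\<close>
  finally have sum_W: "(\<Sum>T\<in>Pow I. W T) = 0" by simp
  have dvd_W: "int p dvd W T" if T: "T \<in> Pow I - {{}}" for T
  proof -
    define U where "U = image_mset ((!) xs) (mset_set T)"
    have finT: "finite T" using T by (auto simp: I_def intro: finite_subset)
    have "S = image_mset ((!) xs) (mset_set I)"
      unfolding I_def xs[symmetric] by (metis map_nth mset_map mset_set_upto_eq_mset_upto)
    then have US: "U \<subseteq># S"
      using T by (auto simp: U_def I_def intro!: image_mset_subseteq_mono subset_imp_msubset_mset_set)
    then have GU: "seq_over G U"
      using S by (auto simp: seq_over_def dest: mset_subset_eqD)
    have U: "U \<noteq> {#}" "size U = card T"
      using T finT by (auto simp: U_def mset_set_empty_iff)
    have sum_U: "(\<Sum>x\<in>#U. x i) = int (s i T)" if "i < r" for i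
    proof -
      have "(xs ! t) i \<ge> 0" if "t \<in> T" for t
      proof -
        have "xs ! t \<in># S" using T that by (auto simp: I_def xs[symmetric])
        then show ?thesis
          using carrier_cyclic_power_nonneg[OF q] S \<open>i < r\<close> unfolding seq_over_def G_def by blast
      qed
      then show ?thesis
        by (simp add: U_def s_def image_mset.compositionality o_def sum_unfold_sum_mset[symmetric])
    qed
    show ?thesis
    proof (cases "zero_sum G U")
      case True
      then have "card T \<in> J" using all_in_J US U by metis
      then have "(\<Prod>j\<in>J. int (card T) - int j) = 0" using J(1) by auto
      then show ?thesis by (simp add: W_def)
    next
      case False
      then obtain i where i: "i < r" "\<not> p ^ n dvd s i T"
        using GU sum_U unfolding G_def by (auto simp: zero_sum_cyclic_power_iff simp flip: of_nat_power)
      then have "int p dvd int ((s i T + N) choose N)"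
        using prime_dvd_binomial_add[OF p] by (simp add: N_def)
      then have "int p dvd (\<Prod>i<r. int ((s i T + N) choose N))"
        using i(1) by (meson dvd_prodI dvd_trans finite_lessThan lessThan_iff)
      then show ?thesis by (simp add: W_def)
    qed
  qed
  have "(\<Sum>T\<in>Pow I. W T) = W {} + (\<Sum>T\<in>Pow I - {{}}. W T)"
    by (intro sum.remove) (auto simp: I_def)
  then have "W {} = - (\<Sum>T\<in>Pow I - {{}}. W T)" using sum_W by simp
  moreover have "int p dvd (\<Sum>T\<in>Pow I - {{}}. W T)" by (intro dvd_sum dvd_W)
  ultimately have "int p dvd W {}" by simp
  \<comment> \<open>At the empty subsequence every binomial coefficient is
    \<open>N choose N\<close>, that is 1.\<close>
  then have "int p dvd (\<Prod>j\<in>J. - int j)" by (simp add: W_def s_def)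
  then obtain j where "j \<in> J" "int p dvd - int j"
    using p J(1) prime_dvd_prod_iff[of J "int p" "\<lambda>j. - int j"] by auto
  then show False using J(2) by auto
qed

lemma exists_zero_sum_submset:
  fixes p n r :: nat
  defines "G \<equiv> cyclic_power (p ^ n) r"
  assumes "prime p" "seq_over G S" "r * (p ^ n - 1) < size S"
  obtains T where "T \<subseteq># S" "T \<noteq> {#}" "zero_sum G T"
  using exists_zero_sum_avoiding_lengths[of p n r S "{}"] assms by auto

section \<open>The extremal sequence\<close>

lemma exists_submset_size:
  assumes "l \<le> size S"
  obtains T where "T \<subseteq># S" "size T = l"
proof -
  obtain xs where xs: "mset xs = S" using ex_mset by blast
  have "mset (take l xs) \<subseteq># S"
    by (metis append_take_drop_id mset_append mset_subset_eq_add_left xs)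
  then show thesis using assms by (intro that[of "mset (take l xs)"]) (auto simp flip: xs)
qed

text \<open>One sequence serves both lower bounds. For \<open>c = 0\<close> the conclusion
  \<open>c > 0\<close> is absurd, so \<open>E\<close> then has no nonempty zero-sum
  subsequence.\<close>

lemma exists_seq_long_zero_sums:
  fixes q r c :: nat
  defines "G \<equiv> cyclic_power q r"
  assumes q: "q > 1" and r: "r \<ge> 2" and c: "c < q"
  obtains E where "seq_over G E" "size E = r * (q - 1) + c"
    "\<And>T. T \<subseteq># E \<Longrightarrow> T \<noteq> {#} \<Longrightarrow> zero_sum G T \<Longrightarrow> c > 0 \<and> r * (q - c) + c \<le> size T"
proof -
  define e where "e l = (\<lambda>i\<in>{..<r}. if i = l then 1 else 0 :: int)" for l
  define u where "u = (\<lambda>i\<in>{..<r}. 1 :: int)"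
  define E where "E = (\<Sum>l<r. replicate_mset (q - 1) (e l)) + replicate_mset c u"
  have e_inj: "e l = e l' \<longleftrightarrow> l = l'" if "l < r" "l' < r" for l l'
    using that by (auto simp: e_def split: if_splits dest: fun_cong[of _ _ l])
  have e_neq_u: "e l \<noteq> u" for l
  proof
    assume "e l = u"
    \<comment> \<open>As \<open>r \<ge> 2\<close>, both coordinates exist; \<open>u\<close> is 1 at
      both of them, \<open>e l\<close> at no more than one.\<close>
    then have "e l 0 = u 0" "e l 1 = u 1" by auto
    then show False using r by (auto simp: e_def u_def split: if_splits)
  qed
  have set_E: "set_mset E \<subseteq> insert u (e ` {..<r})"
    by (auto simp: E_def set_mset_sum split: if_splits)
  have carrier: "seq_over G E"
    using set_E q unfolding seq_over_def G_def cyclic_power_def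
    by (fastforce simp: carrier_integer_mod_group e_def u_def)
  have size: "size E = r * (q - 1) + c"
    by (simp add: E_def)
  have sums: "size T = (\<Sum>l<r. count T (e l)) + count T u"
      "i < r \<Longrightarrow> (\<Sum>x\<in>#T. x i) = int (count T (e i) + count T u)"
    if "set_mset T \<subseteq> insert u (e ` {..<r})" for T i
    using that
  proof (induction T)
    case (add x T)
    {
      case 1
      show ?case
      proof (cases "x = u")
        case True
        then show ?thesis using 1 add.IH(1) e_neq_u by (simp add: eq_commute[of u])
      next
        case False
        then obtain l where l: "l < r" "x = e l" using 1 by auto
        have "(\<Sum>l'<r. count (add_mset x T) (e l')) = (\<Sum>l'<r. (if l' = l then 1 else 0) + count T (e l'))"
          using l by (intro sum.cong) (auto simp: e_inj)
        then show ?thesis using 1 add.IH(1) l e_neq_u by (simp add: sum.distrib)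
      qed
    next
      case 2
      show ?case
      proof (cases "x = u")
        case True
        then have "x i = 1" "x \<noteq> e i" using 2 e_neq_u[of i] by (auto simp: u_def)
        then show ?thesis using 2 add.IH(2) True by simp
      next
        case False
        then obtain l where l: "l < r" "x = e l" using 2 by auto
        have "x i = (if e i = x then 1 else 0)"
          using l 2 by (auto simp: e_inj) (auto simp: e_def)
        then show ?thesis using 2 add.IH(2) l e_neq_u by auto
      qed
    }
  qed auto
  show thesis
  proof (rule that[OF carrier size])
    fix T assume T: "T \<subseteq># E" "T \<noteq> {#}" "zero_sum G T"
    then have set_T: "set_mset T \<subseteq> insert u (e ` {..<r})"
      using set_E set_mset_mono by blast
    define j where "j = count T u"
    have "count E u = c"
      using e_neq_u[THEN not_sym] by (simp add: E_def count_sum)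
    then have j: "j \<le> c" using T(1) by (metis j_def mset_subset_eq_count)
    have "seq_over G T" using T(1) carrier unfolding seq_over_def by (meson set_mset_mono subset_trans)
    then have dvd: "q dvd count T (e i) + j" if "i < r" for i
      using T(3) that sums(2)[OF set_T] unfolding G_def
      by (auto simp: zero_sum_cyclic_power_iff j_def simp del: of_nat_add)
    have count_le: "count T (e i) \<le> q - 1" if "i < r" for i
    proof -
      have "count E (e i) = (\<Sum>l<r. if l = i then q - 1 else 0)"
        using that e_neq_u unfolding E_def by (auto simp: count_sum e_inj eq_commute[of u] intro!: sum.cong)
      also have "\<dots> = q - 1" using that by simp
      finally show ?thesis using T(1) by (metis mset_subset_eq_count)
    qed
    have "j > 0"
    proof (rule ccontr)
      assume "\<not> j > 0"
      \<comment> \<open>Without copies of \<open>u\<close>, each multiplicity is a multiple of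
        \<open>q\<close> that is at most \<open>q - 1\<close>.\<close>
      then have "count T (e i) = 0" if "i < r" for i
        using dvd[OF that] count_le[OF that] q by (auto dest: dvd_imp_le)
      then have "size T = 0" using sums(1)[OF set_T] \<open>\<not> j > 0\<close> by (simp add: j_def not_in_iff)
      with T(2) show False by simp
    qed
    have "q - j \<le> count T (e i)" if "i < r" for i
      using dvd_imp_le[OF dvd[OF that]] \<open>j > 0\<close> by simp
    then have "(\<Sum>l<r. q - j) \<le> (\<Sum>l<r. count T (e l))"
      by (intro sum_mono) auto
    then have "r * (q - j) + j \<le> size T"
      unfolding sums(1)[OF set_T] by (simp add: j_def)
    \<comment> \<open>Trading one more copy of \<open>u\<close> for one copy less of each basis
      element never lengthens \<open>T\<close>, so \<open>j = c\<close> is the extreme case.\<close>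
    moreover have "r * (q - c) + c \<le> r * (q - j) + j"
    proof -
      have "q - j = (q - c) + (c - j)" using j c by simp
      then have "r * (q - j) = r * (q - c) + r * (c - j)" by (simp add: add_mult_distrib2)
      moreover have "c - j \<le> r * (c - j)" using r by simp
      ultimately show ?thesis using j by linarith
    qed
    ultimately show "c > 0 \<and> r * (q - c) + c \<le> size T"
      using \<open>j > 0\<close> j by simp
  qed
qed

section \<open>The Davenport constant and the two bounds\<close>

lemma davenport_cyclic_power:
  fixes p n r :: nat
  assumes p: "prime p" and "n \<ge> 1" and r: "r \<ge> 2"
  shows "davenport (cyclic_power (p ^ n) r) = r * (p ^ n - 1) + 1"
  unfolding davenport_def
proof (rule Least_equality)
  let ?G = "cyclic_power (p ^ n) r"
  show "\<forall>S. seq_over ?G S \<and> size S = r * (p ^ n - 1) + 1 \<longrightarrow>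
      (\<exists>T. T \<subseteq># S \<and> T \<noteq> {#} \<and> zero_sum ?G T)"
    using exists_zero_sum_submset[OF p] by (metis less_add_one)
  fix l assume l: "\<forall>S. seq_over ?G S \<and> size S = l \<longrightarrow> (\<exists>T. T \<subseteq># S \<and> T \<noteq> {#} \<and> zero_sum ?G T)"
  have q: "p ^ n > 1" using prime_gt_1_nat[OF p] \<open>n \<ge> 1\<close> by (intro one_less_power) auto
  then obtain E where E: "seq_over ?G E" "size E = r * (p ^ n - 1)"
    "\<And>T. T \<subseteq># E \<Longrightarrow> T \<noteq> {#} \<Longrightarrow> \<not> zero_sum ?G T"
    using exists_seq_long_zero_sums[OF q r, of 0] q
    by (metis add_0_right less_irrefl less_trans zero_less_one)
  show "r * (p ^ n - 1) + 1 \<le> l"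
  proof (rule ccontr)
    assume "\<not> ?thesis"
    then obtain S where S: "S \<subseteq># E" "size S = l"
      using exists_submset_size[of l E] E(2) by auto
    then have "seq_over ?G S" using E(1) unfolding seq_over_def by (meson set_mset_mono subset_trans)
    with l S(2) obtain T where "T \<subseteq># S" "T \<noteq> {#}" "zero_sum ?G T" by blast
    with S(1) E(3) show False by (blast intro: subset_mset.order_trans)
  qed
qed

theorem theorem1p5:
  fixes p r n k :: nat and G :: "(nat \<Rightarrow> int) monoid"
  assumes "Factorial_Ring.prime p"
    and "n \<ge> 1"
    and "3 \<le> r" and "r < p"
    and "G = cyclic_power (p ^ n) r"
    and "2 \<le> k" and "k \<le> p - r + 1"
  shows "int (davenport G) + \<lceil>real k / (real r - 1)\<rceil> \<le> int (s_le (davenport G - k) G)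
    \<and> s_le (davenport G - k) G \<le> davenport G + k"
proof -
  define q where "q = p ^ n"
  define D where "D = r * (q - 1) + 1"
  define P where "P l \<longleftrightarrow> (\<forall>S. seq_over G S \<and> size S = l \<longrightarrow>
     (\<exists>T. T \<subseteq># S \<and> 1 \<le> size T \<and> size T \<le> D - k \<and> zero_sum G T))" for l
  have q: "p \<le> q" "p dvd q" "q > 1"
    using assms self_le_power[of p n] unfolding q_def by auto
  have G: "G = cyclic_power q r" using assms by (simp add: q_def)
  have D: "davenport G = D"
    using davenport_cyclic_power[of p n r] assms by (simp add: D_def q_def)
  have Drq: "D + r = r * q + 1"
    using q by (simp add: D_def diff_mult_distrib2)
  have "3 * (p - 1) \<le> r * (q - 1)"
    using assms q by (intro mult_le_mono) auto
  \<comment> \<open>This keeps \<open>D - k\<close> from truncating and gives 2 (D - k + 1) > D + k,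
    so two disjoint subsequences longer than \<open>D - k\<close> do not fit into
    \<open>D + k\<close> terms.\<close>
  then have kD: "3 * k \<le> D + 1"
    using assms unfolding D_def by linarith
  have s_le: "s_le (davenport G - k) G = (LEAST l. P l)"
    by (simp add: D s_le_def P_def)
  have sub: "seq_over G T" if "T \<subseteq># S" "seq_over G S" for S T
    using that unfolding seq_over_def by (meson set_mset_mono subset_trans)

  have upper: "P (D + k)"
    unfolding P_def
  proof (intro allI impI, elim conjE, rule ccontr)
    fix S assume S: "seq_over G S" "size S = D + k"
      and "\<not> (\<exists>T. T \<subseteq># S \<and> 1 \<le> size T \<and> size T \<le> D - k \<and> zero_sum G T)"
    then have long: "size T > D - k" if "T \<subseteq># S" "T \<noteq> {#}" "zero_sum G T" for T
      using that by (metis One_nat_def Suc_leI nonempty_has_size not_le)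
    have not_dvd: "\<not> p dvd j" if "j \<in> {D - k + 1..D}" for j
    proof
      assume "p dvd j"
      then have "p dvd r * q - j" using q by simp
      \<comment> \<open>Since D = r q - r + 1, the difference r q - j lies between r - 1 and r + k -
        2, and the latter is at most p - 1 by the bound on \<open>k\<close>.\<close>
      moreover have "0 < r * q - j" "r * q - j < p"
        using that Drq assms kD by auto
      ultimately show False by (auto dest: dvd_imp_le)
    qed
    obtain T where T: "T \<subseteq># S" "T \<noteq> {#}" "zero_sum G T" "size T \<notin> {D - k + 1..D}"
    proof (rule exists_zero_sum_avoiding_lengths[of p n r S "{D - k + 1..D}"])
      show "r * (p ^ n - 1) + card {D - k + 1..D} < size S"
        using S(2) kD by (simp add: D_def q_def)
    qed (use S(1) assms not_dvd in auto)
    then have "D < size T" using long by fastforce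
    \<comment> \<open>Restricting to \<open>D\<close> terms of \<open>T\<close> bounds the length of
      \<open>U\<close> by \<open>D\<close>, so its complement in \<open>T\<close> is
      nonempty.\<close>
    then obtain V where V: "V \<subseteq># T" "size V = D"
      using exists_submset_size[of D T] by auto
    then have "seq_over G V" using S T sub by blast
    then obtain U where U: "U \<subseteq># V" "U \<noteq> {#}" "zero_sum G U"
      using exists_zero_sum_submset[of p n r V] assms V by (auto simp: D_def q_def)
    have UT: "U \<subseteq># T" using U V by simp
    have "size U \<le> D" using U V size_mset_mono by metis
    have TU: "T - U \<subseteq># S" using T(1) by (meson diff_subset_eq_self subset_mset.order_trans)
    have "zero_sum G (T - U)"
    proof -
      have "(\<Sum>x\<in>#T. x i) = (\<Sum>x\<in>#T - U. x i) + (\<Sum>x\<in>#U. x i)" for i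
        using UT by (metis image_mset_union subset_mset.diff_add sum_mset.union)
      moreover have "seq_over G T" "seq_over G U" "seq_over G (T - U)"
        using S(1) T(1) UT TU sub by blast+
      ultimately show ?thesis
        using T(3) U(3) unfolding G by (simp add: zero_sum_cyclic_power_iff dvd_add_left_iff)
    qed
    moreover have size_TU: "size (T - U) = size T - size U" using UT by (simp add: size_Diff_submset)
    moreover have "T - U \<noteq> {#}"
      using \<open>D < size T\<close> \<open>size U \<le> D\<close> size_TU by auto
    ultimately have "size T - size U > D - k" using long TU by metis
    moreover have "size U > D - k" using long U UT T(1) by (meson subset_mset.order_trans)
    moreover have "size T \<le> D + k" using T(1) S(2) size_mset_mono by metis
    ultimately show False using kD by linarith
  qed

  define c where "c = nat \<lceil>real k / (real r - 1)\<rceil>"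
  have c: "int c = \<lceil>real k / (real r - 1)\<rceil>"
    using assms unfolding c_def by (intro nat_0_le, subst zero_le_ceiling) (simp add: less_le_trans[of _ 0])
  \<comment> \<open>Clearing the denominator and using integrality gives c (r - 1) <= k + r -
    2.\<close>
  have "real c < real k / (real r - 1) + 1"
    using c ceiling_correct[of "real k / (real r - 1)"] by linarith
  then have "real c * (real r - 1) < real k + real r - 1"
    using assms by (simp add: field_simps)
  then have "real (c * r) < real (k + r + c - 1)"
    using assms by (simp add: algebra_simps)
  then have cr: "c * r + 2 \<le> k + r + c" using assms by linarith
  have "real k / (real r - 1) \<le> real k / 1"
    using assms by (intro divide_left_mono) auto
  then have "c \<le> k" using c by linarith
  then have cq: "c < q" using assms q by linarith
  have "D + c \<le> l" if "P l" for l
  proof (rule ccontr)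
    assume "\<not> ?thesis"
    obtain E where E: "seq_over G E" "size E = r * (q - 1) + c"
      "\<And>T. T \<subseteq># E \<Longrightarrow> T \<noteq> {#} \<Longrightarrow> zero_sum G T \<Longrightarrow> c > 0 \<and> r * (q - c) + c \<le> size T"
      using exists_seq_long_zero_sums[of q r c] assms q cq unfolding G by auto
    \<comment> \<open>\<open>E\<close> has exactly D + c - 1 terms, so any l < D + c is the length
      of a subsequence.\<close>
    then obtain S where S: "S \<subseteq># E" "size S = l"
      using exists_submset_size[of l E] \<open>\<not> D + c \<le> l\<close> by (auto simp: D_def)
    then obtain T where T: "T \<subseteq># S" "1 \<le> size T" "size T \<le> D - k" "zero_sum G T"
      using \<open>P l\<close> E(1) sub unfolding P_def by metis
    then have "r * (q - c) + c \<le> D - k"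
      using E(3)[of T] S(1) by (metis le_trans not_one_le_zero size_empty subset_mset.order_trans)
    moreover have "r * q = r * (q - c) + c * r"
      using cq by (metis add_mult_distrib2 le_add_diff_inverse2 less_imp_le mult.commute)
    \<comment> \<open>The two facts give c (r - 1) >= k + r - 1, against \<open>cr\<close>.\<close>
    ultimately show False using Drq cr kD assms by linarith
  qed
  \<comment> \<open>\<open>upper\<close> also shows that some length satisfies \<open>P\<close>, so
    that \<open>LEAST\<close> is meaningful here.\<close>
  then have "D + c \<le> (LEAST l. P l)" using LeastI[of P, OF upper] by blast
  then show ?thesis
    using Least_le[of P, OF upper] unfolding s_le unfolding D c[symmetric] by simp
qed

end
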